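(* Let $G(p)$ be a continuous tensegrity in $\mathbb{R}^n$ with (compact) edgeset $\mathscr{E}$, rigidity operator $Y$ and space of design variations $\mathcal{X}$. If $G(p)$ is countably covered by subtensegrities that have a strictly positive stress, then $G(p)$ has a strictly positive stress.
   Context: A (continuous) tensegrity $G(p)$ in $\mathbb{R}^n$ consists of a (possibly infinite) set $\mathscr{V}$ of vertices, an injective map $p:\mathscr{V}\to\mathbb{R}^n$, and three pairwise disjoint sets $\mathsf{S}$ (struts), $\mathsf{C}$ (cables), $\mathsf{B}$ (bars) of two-element subsets of $\mathscr{V}$. The set $\mathscr{V}$ carries the metric $d_{\mathscr V}(v,w)=\|p(v)-p(w)\|$. Put $\mathscr{S}=\mathsf{S}\cup\mathsf{B}$ and $\mathscr{C}=\mathsf{C}\cup\mathsf{B}$ (functional struts and cables). The edgeset is the disjoint union $\mathscr{E}=\mathscr{S}\sqcup\mathscr{C}$ (so a bar occurs twice, once as a strut and once as a cable). Two edges of the same type have distance $\min\{\max(d_{\mathscr V}(v_1,v_3),d_{\mathscr V}(v_2,v_4)),\max(d_{\mathscr V}(v_1,v_4),d_{\mathscr V}(v_2,v_3))\}$ for edges $\{v_1,v_2\},\{v_3,v_4\}$; edges of different types have distance $\infty$. $\mathscr{E}$ has the metric topology and is required to be compact. $\mathrm{Vf}(\mathscr{V})$ is the space of continuous maps $V:\mathscr{V}\to\mathbb{R}^n$ (variations). $T(p)$ is the set of Euclidean motions, i.e. variations $v\mapsto Mp(v)+t$ with $M$ a skew-symmetric $n\times n$ matrix and $t\in\mathbb{R}^n$.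 The design variations form a linear subspace $\mathcal{X}\subset\mathrm{Vf}(\mathscr{V})$ with $T(p)\subset\mathcal{X}$. The rigidity operator $Y:\mathrm{Vf}(\mathscr{V})\to C(\mathscr{E})$ is $(YV)(\{v_1,v_2\})=\pm(V(v_1)-V(v_2))\cdot(p(v_1)-p(v_2))$, with sign $+$ on $\mathscr{S}$ and $-$ on $\mathscr{C}$. $C(\mathscr{E})$ is the space of continuous real functions on $\mathscr{E}$ with the sup norm, $C(\mathscr{E})^+$ the set of nonnegative ones, and $C^*(\mathscr{E})$ the topological dual of $C(\mathscr{E})$. A stress is a $\mu\in C^*(\mathscr{E})$ with $\mu(YV)=0$ for all $V\in\mathcal{X}$; a strictly positive stress is a stress $\mu$ with $\mu(f)>0$ for all nonzero $f\in C(\mathscr{E})^+$. A subtensegrity of $G(p)$ is obtained by keeping $\mathscr{V}$, $p$ and $\mathcal{X}$ and restricting the edgeset to a compact subset $\mathscr{E}'\subset\mathscr{E}$; its rigidity operator is $V\mapsto(YV)|_{\mathscr{E}'}$. A stress of this subtensegrity is a $\mu\in C^*(\mathscr{E}')$ (the topological dual of the space $C(\mathscr{E}')$ of continuous real functions on $\mathscr{E}'$ with the sup norm) with $\mu((YV)|_{\mathscr{E}'})=0$ for all $V\in\mathcal{X}$; a strictly positive stress of it is such a stress $\mu$ with $\mu(f)>0$ for all nonzero nonnegative $f\in C(\mathscr{E}')$. $G(p)$ is countably covered by a class of subtensegrities if there is a countable dense subset $\{e_n\}\subset\mathscr{E}$ such that every $e_n$ belongs to (the edgeset of) a subtensegrity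 of that class. *)

theory Defs
  imports "HOL-Analysis.Analysis"
begin

text \<open>
  The spaces of functions on a carrier (variations on the vertices, continuous functions on an
  edgeset) are represented by total functions vanishing outside the carrier. These correspond
  bijectively to the functions on the carrier, and the pointwise vector space operations and
  the equality of HOL functions are those of the function space.
\<close>

definition vertex_dist :: "('v \<Rightarrow> real^'n) \<Rightarrow> 'v \<Rightarrow> 'v \<Rightarrow> real" where
  "vertex_dist p v w = norm (p v - p w)"

lemma Metric_space_vertex_dist:
  assumes "inj_on p \<V>"
  shows "Metric_space \<V> (vertex_dist p)"
proof
  fix x y z
  show "0 \<le> vertex_dist p x y" "vertex_dist p x y = vertex_dist p y x"
    by (simp_all add: vertex_dist_def norm_minus_commute)
  show "x \<in> \<V> \<Longrightarrow> y \<in> \<V> \<Longrightarrow> vertex_dist p x y = 0 \<longleftrightarrow> x = y"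
    using assms by (auto simp: vertex_dist_def dest: inj_onD)
  show "vertex_dist p x z \<le> vertex_dist p x y + vertex_dist p y z"
    using norm_triangle_ineq[of "p x - p y" "p y - p z"] by (simp add: vertex_dist_def)
qed


text \<open>
  The disjoint union of functional struts and functional cables: \<open>Inl\<close> tags a strut,
  \<open>Inr\<close> a cable, so that a bar occurs under both tags.
\<close>

type_synonym 'v edge = "'v set + 'v set"

text \<open>
  The description below does not depend on the order in which the endpoints are listed, see
  \<open>pair_dist_doubleton\<close>; the same holds for \<open>pair_strain\<close> further down.
\<close>

definition pair_dist :: "('v \<Rightarrow> real^'n) \<Rightarrow> 'v set \<Rightarrow> 'v set \<Rightarrow> real" where
  "pair_dist p e f = (THE d. \<exists>v1 v2 v3 v4. e = {v1, v2} \<and> f = {v3, v4} \<and>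
     d = min (max (vertex_dist p v1 v3) (vertex_dist p v2 v4))
             (max (vertex_dist p v1 v4) (vertex_dist p v2 v3)))"

lemma pair_dist_doubleton:
  "pair_dist p {v1, v2} {v3, v4} =
     min (max (vertex_dist p v1 v3) (vertex_dist p v2 v4))
         (max (vertex_dist p v1 v4) (vertex_dist p v2 v3))"
  unfolding pair_dist_def
proof (rule the_equality)
  show "\<exists>w1 w2 w3 w4. {v1, v2} = {w1, w2} \<and> {v3, v4} = {w3, w4} \<and>
     min (max (vertex_dist p v1 v3) (vertex_dist p v2 v4))
         (max (vertex_dist p v1 v4) (vertex_dist p v2 v3)) =
     min (max (vertex_dist p w1 w3) (vertex_dist p w2 w4))
         (max (vertex_dist p w1 w4) (vertex_dist p w2 w3))"
    by blast
qed (auto simp: doubleton_eq_iff max.commute min.commute)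

fun edge_dist :: "('v \<Rightarrow> real^'n) \<Rightarrow> 'v edge \<Rightarrow> 'v edge \<Rightarrow> ereal" where
  "edge_dist p (Inl e) (Inl f) = ereal (pair_dist p e f)"
| "edge_dist p (Inr e) (Inr f) = ereal (pair_dist p e f)"
| "edge_dist p (Inl e) (Inr f) = \<infinity>"
| "edge_dist p (Inr e) (Inl f) = \<infinity>"

text \<open>
  The metric topology, written out because \<open>Metric_space\<close> only admits real-valued metrics.
\<close>

definition edge_topology :: "('v \<Rightarrow> real^'n) \<Rightarrow> 'v edge set \<Rightarrow> 'v edge topology" where
  "edge_topology p \<E> =
     topology (\<lambda>U. U \<subseteq> \<E> \<and> (\<forall>e\<in>U. \<exists>r>0. \<forall>f\<in>\<E>. edge_dist p e f < ereal r \<longrightarrow> f \<in> U))"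

lemma openin_edge_topology:
  "openin (edge_topology p \<E>) U \<longleftrightarrow>
     U \<subseteq> \<E> \<and> (\<forall>e\<in>U. \<exists>r>0. \<forall>f\<in>\<E>. edge_dist p e f < ereal r \<longrightarrow> f \<in> U)"
proof -
  let ?P = "\<lambda>U. U \<subseteq> \<E> \<and> (\<forall>e\<in>U. \<exists>r>0. \<forall>f\<in>\<E>. edge_dist p e f < ereal r \<longrightarrow> f \<in> U)"
  have "istopology ?P"
    unfolding istopology_def
  proof (intro conjI allI impI)
    fix S T assume S: "?P S" and T: "?P T"
    show "S \<inter> T \<subseteq> \<E>" using S by blast
    show "\<forall>e\<in>S \<inter> T. \<exists>r>0. \<forall>f\<in>\<E>. edge_dist p e f < ereal r \<longrightarrow> f \<in> S \<inter> T"
    proof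
      fix e assume "e \<in> S \<inter> T"
      then obtain r s where "r > 0" "\<forall>f\<in>\<E>. edge_dist p e f < ereal r \<longrightarrow> f \<in> S"
        and "s > 0" "\<forall>f\<in>\<E>. edge_dist p e f < ereal s \<longrightarrow> f \<in> T"
        using S T by blast
      moreover have "ereal (min r s) \<le> ereal r" "ereal (min r s) \<le> ereal s" by simp_all
      ultimately have "min r s > 0"
        "\<forall>f\<in>\<E>. edge_dist p e f < ereal (min r s) \<longrightarrow> f \<in> S \<inter> T"
        using less_le_trans by (simp, blast)
      then show "\<exists>r>0. \<forall>f\<in>\<E>. edge_dist p e f < ereal r \<longrightarrow> f \<in> S \<inter> T" by blast
    qed
  next
    fix \<K> assume K: "\<forall>K\<in>\<K>. ?P K"
    show "\<Union>\<K> \<subseteq> \<E>" using K by blast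
    show "\<forall>e\<in>\<Union>\<K>. \<exists>r>0. \<forall>f\<in>\<E>. edge_dist p e f < ereal r \<longrightarrow> f \<in> \<Union>\<K>"
    proof
      fix e assume "e \<in> \<Union>\<K>"
      then obtain K where "K \<in> \<K>" "e \<in> K" by blast
      moreover from this K obtain r where "r > 0" "\<forall>f\<in>\<E>. edge_dist p e f < ereal r \<longrightarrow> f \<in> K"
        by blast
      ultimately show "\<exists>r>0. \<forall>f\<in>\<E>. edge_dist p e f < ereal r \<longrightarrow> f \<in> \<Union>\<K>" by blast
    qed
  qed
  then show ?thesis by (simp add: edge_topology_def topology_inverse')
qed

lemma topspace_edge_topology: "topspace (edge_topology p \<E>) = \<E>"
proof
  show "topspace (edge_topology p \<E>) \<subseteq> \<E>"
    using openin_topspace openin_edge_topology by blast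
  have "openin (edge_topology p \<E>) \<E>"
    unfolding openin_edge_topology using zero_less_one by blast
  then show "\<E> \<subseteq> topspace (edge_topology p \<E>)" by (rule openin_subset)
qed


definition variations :: "'v set \<Rightarrow> ('v \<Rightarrow> real^'n) \<Rightarrow> ('v \<Rightarrow> real^'n) set" where
  "variations \<V> p =
     {V. continuous_map (Metric_space.mtopology \<V> (vertex_dist p)) euclidean V \<and>
         (\<forall>v. v \<notin> \<V> \<longrightarrow> V v = 0)}"

definition euclidean_motions :: "'v set \<Rightarrow> ('v \<Rightarrow> real^'n) \<Rightarrow> ('v \<Rightarrow> real^'n) set" where
  "euclidean_motions \<V> p =
     {(\<lambda>v. if v \<in> \<V> then M *v p v + t else 0) |(M :: real^'n^'n) t. transpose M = - M}"

definition linear_subspace :: "('v \<Rightarrow> real^'n) set \<Rightarrow> bool" where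
  "linear_subspace \<X> \<longleftrightarrow>
     (\<lambda>v. 0) \<in> \<X> \<and>
     (\<forall>V\<in>\<X>. \<forall>W\<in>\<X>. (\<lambda>v. V v + W v) \<in> \<X>) \<and>
     (\<forall>c. \<forall>V\<in>\<X>. (\<lambda>v. c *\<^sub>R V v) \<in> \<X>)"

definition edgeset :: "'v set set \<Rightarrow> 'v set set \<Rightarrow> 'v set set \<Rightarrow> 'v edge set" where
  "edgeset S C B = (S \<union> B) <+> (C \<union> B)"

definition tensegrity ::
  "'v set \<Rightarrow> ('v \<Rightarrow> real^'n) \<Rightarrow> 'v set set \<Rightarrow> 'v set set \<Rightarrow> 'v set set \<Rightarrow>
   ('v \<Rightarrow> real^'n) set \<Rightarrow> bool" where
  "tensegrity \<V> p S C B \<X> \<longleftrightarrow>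
     inj_on p \<V> \<and>
     S \<inter> C = {} \<and> S \<inter> B = {} \<and> C \<inter> B = {} \<and>
     (\<forall>e \<in> S \<union> C \<union> B. e \<subseteq> \<V> \<and> card e = 2) \<and>
     compact_space (edge_topology p (edgeset S C B)) \<and>
     \<X> \<subseteq> variations \<V> p \<and> linear_subspace \<X> \<and> euclidean_motions \<V> p \<subseteq> \<X>"


definition pair_strain :: "('v \<Rightarrow> real^'n) \<Rightarrow> ('v \<Rightarrow> real^'n) \<Rightarrow> 'v set \<Rightarrow> real" where
  "pair_strain p V e =
     (THE x. \<exists>v1 v2. e = {v1, v2} \<and> x = (V v1 - V v2) \<bullet> (p v1 - p v2))"

lemma pair_strain_doubleton:
  "pair_strain p V {v1, v2} = (V v1 - V v2) \<bullet> (p v1 - p v2)"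
  unfolding pair_strain_def
proof (rule the_equality)
  show "\<exists>w1 w2. {v1, v2} = {w1, w2} \<and>
      (V v1 - V v2) \<bullet> (p v1 - p v2) = (V w1 - V w2) \<bullet> (p w1 - p w2)"
    by blast
qed (auto simp: doubleton_eq_iff inner_diff_left inner_diff_right)

text \<open>
  The edgeset is an argument, so that the same operator serves a tensegrity and its
  subtensegrities, see \<open>rigidity_restrict\<close>.
\<close>

definition rigidity ::
  "('v \<Rightarrow> real^'n) \<Rightarrow> 'v edge set \<Rightarrow> ('v \<Rightarrow> real^'n) \<Rightarrow> 'v edge \<Rightarrow> real" where
  "rigidity p \<E> V e =
     (if e \<in> \<E> then case e of Inl s \<Rightarrow> pair_strain p V s | Inr c \<Rightarrow> - pair_strain p V c else 0)"

lemma rigidity_restrict: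
  "\<E>' \<subseteq> \<E> \<Longrightarrow> rigidity p \<E>' V = (\<lambda>e. if e \<in> \<E>' then rigidity p \<E> V e else 0)"
  by (auto simp: rigidity_def fun_eq_iff)


definition cont_fun :: "('v \<Rightarrow> real^'n) \<Rightarrow> 'v edge set \<Rightarrow> ('v edge \<Rightarrow> real) set" where
  "cont_fun p \<E> =
     {f. continuous_map (edge_topology p \<E>) euclideanreal f \<and> (\<forall>e. e \<notin> \<E> \<longrightarrow> f e = 0)}"

text \<open>
  For functions vanishing outside the edgeset the supremum over the whole type is the supremum
  over the edgeset, and it is 0 rather than unspecified if the edgeset is empty.
\<close>

definition sup_norm :: "('v edge \<Rightarrow> real) \<Rightarrow> real" where
  "sup_norm f = (SUP e. \<bar>f e\<bar>)"

text \<open>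
  The topological dual: functionals that are linear and bounded (in the sense of
  \<open>bounded_linear\<close>) for the sup norm. Only the values on \<open>cont_fun p \<E>\<close> matter.
\<close>

definition dual_space :: "('v \<Rightarrow> real^'n) \<Rightarrow> 'v edge set \<Rightarrow> (('v edge \<Rightarrow> real) \<Rightarrow> real) set" where
  "dual_space p \<E> =
     {\<mu>. (\<forall>f\<in>cont_fun p \<E>. \<forall>g\<in>cont_fun p \<E>. \<mu> (\<lambda>e. f e + g e) = \<mu> f + \<mu> g) \<and>
         (\<forall>c. \<forall>f\<in>cont_fun p \<E>. \<mu> (\<lambda>e. c * f e) = c * \<mu> f) \<and>
         (\<exists>K. \<forall>f\<in>cont_fun p \<E>. \<bar>\<mu> f\<bar> \<le> sup_norm f * K)}"

definition stress ::
  "('v \<Rightarrow> real^'n) \<Rightarrow> ('v \<Rightarrow> real^'n) set \<Rightarrow> 'v edge set \<Rightarrow> (('v edge \<Rightarrow> real) \<Rightarrow> real) \<Rightarrow> bool"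
  where
  "stress p \<X> \<E> \<mu> \<longleftrightarrow> \<mu> \<in> dual_space p \<E> \<and> (\<forall>V\<in>\<X>. \<mu> (rigidity p \<E> V) = 0)"

definition strictly_positive_stress ::
  "('v \<Rightarrow> real^'n) \<Rightarrow> ('v \<Rightarrow> real^'n) set \<Rightarrow> 'v edge set \<Rightarrow> (('v edge \<Rightarrow> real) \<Rightarrow> real) \<Rightarrow> bool"
  where
  "strictly_positive_stress p \<X> \<E> \<mu> \<longleftrightarrow>
     stress p \<X> \<E> \<mu> \<and>
     (\<forall>f\<in>cont_fun p \<E>. (\<forall>e\<in>\<E>. 0 \<le> f e) \<and> f \<noteq> (\<lambda>e. 0) \<longrightarrow> 0 < \<mu> f)"

text \<open>
  A subtensegrity keeps the vertices, \<open>p\<close> and the design variations, so it is given by its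
  edgeset, and a class of subtensegrities by a predicate \<open>P\<close> on edgesets.
\<close>

definition countably_covered ::
  "('v \<Rightarrow> real^'n) \<Rightarrow> 'v edge set \<Rightarrow> ('v edge set \<Rightarrow> bool) \<Rightarrow> bool" where
  "countably_covered p \<E> P \<longleftrightarrow>
     (\<exists>D. countable D \<and> D \<subseteq> \<E> \<and> edge_topology p \<E> closure_of D = \<E> \<and>
        (\<forall>e\<in>D. \<exists>\<E>'. compactin (edge_topology p \<E>) \<E>' \<and> P \<E>' \<and> e \<in> \<E>'))"

end

theory Submission
  imports Defs
begin

text \<open>
  Pull the strictly positive stresses of the subtensegrities that contain the points of the
  countable dense set back along restriction, and add them up with weights making the series of
  norms converge. A nonzero nonnegative function is positive on a nonempty open set, hence at a
  point of the dense set, so at least one term of the series is positive on it.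
\<close>

text \<open>The restriction map from functions on \<open>\<E>\<close> to functions on
  \<open>\<E>'\<close>; the value 0 off \<open>\<E>'\<close> is what the representation by total
  functions demands.\<close>

definition restrict_fun :: "'v edge set \<Rightarrow> ('v edge \<Rightarrow> real) \<Rightarrow> 'v edge \<Rightarrow> real" where
  "restrict_fun \<E>' f e = (if e \<in> \<E>' then f e else 0)"

lemma restrict_fun_add:
  "restrict_fun \<E>' (\<lambda>e. f e + g e) = (\<lambda>e. restrict_fun \<E>' f e + restrict_fun \<E>' g e)"
  by (auto simp: restrict_fun_def)

lemma restrict_fun_scale:
  "restrict_fun \<E>' (\<lambda>e. c * f e) = (\<lambda>e. c * restrict_fun \<E>' f e)"
  by (auto simp: restrict_fun_def)

lemma restrict_fun_rigidity:
  "\<E>' \<subseteq> \<E> \<Longrightarrow> restrict_fun \<E>' (rigidity p \<E> V) = rigidity p \<E>' V"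
  by (auto simp: restrict_fun_def rigidity_restrict[of \<E>' \<E>])

text \<open>Both topologies come from the same \<open>edge_dist\<close>, so a radius that works
  around an edge in \<open>\<E>\<close> also works in \<open>\<E>'\<close>. Composing with this
  inclusion makes restrictions of continuous functions continuous.\<close>

lemma continuous_map_edge_topology_subset:
  assumes "\<E>' \<subseteq> \<E>"
  shows "continuous_map (edge_topology p \<E>') (edge_topology p \<E>) (\<lambda>e. e)"
  unfolding continuous_map_def
proof (intro conjI allI impI)
  show "(\<lambda>e. e) \<in> topspace (edge_topology p \<E>') \<rightarrow> topspace (edge_topology p \<E>)"
    using assms by (auto simp: topspace_edge_topology)
  fix U assume "openin (edge_topology p \<E>) U"
  then show "openin (edge_topology p \<E>') {e \<in> topspace (edge_topology p \<E>'). e \<in> U}"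
    using assms unfolding openin_edge_topology topspace_edge_topology by blast
qed

lemma restrict_fun_cont_fun:
  assumes "\<E>' \<subseteq> \<E>" "f \<in> cont_fun p \<E>"
  shows "restrict_fun \<E>' f \<in> cont_fun p \<E>'"
proof -
  have "continuous_map (edge_topology p \<E>') euclideanreal (f \<circ> (\<lambda>e. e))"
    using assms by (intro continuous_map_compose[OF continuous_map_edge_topology_subset])
      (auto simp: cont_fun_def)
  then have "continuous_map (edge_topology p \<E>') euclideanreal (restrict_fun \<E>' f)"
    by (rule continuous_map_eq) (simp add: topspace_edge_topology restrict_fun_def)
  then show ?thesis by (simp add: cont_fun_def restrict_fun_def)
qed

text \<open>A real \<open>SUP\<close> can only be estimated once the range is known to be bounded;
  compactness of the edgeset supplies this for \<open>sup_norm\<close>.\<close>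

lemma cont_fun_bdd_above:
  assumes "compact_space (edge_topology p \<E>)" "f \<in> cont_fun p \<E>"
  shows "bdd_above (range (\<lambda>e. \<bar>f e\<bar>))"
proof -
  have "compactin euclideanreal (f ` \<E>)"
    using assms image_compactin[of "edge_topology p \<E>" \<E> euclideanreal f]
    by (simp add: compact_space_def topspace_edge_topology cont_fun_def)
  then have "bounded (f ` \<E>)" by (simp add: compact_imp_bounded)
  then obtain b where b: "\<And>e. e \<in> \<E> \<Longrightarrow> \<bar>f e\<bar> \<le> b" by (auto simp: bounded_iff)
  \<comment> \<open>If \<open>\<E>\<close> is empty, \<open>b\<close> may be negative, while
    \<open>f\<close> still takes the value 0 off \<open>\<E>\<close>.\<close>
  have "\<bar>f e\<bar> \<le> max b 0" for e
    using assms(2) b[of e] by (cases "e \<in> \<E>") (auto simp: cont_fun_def)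
  then show ?thesis by (intro bdd_aboveI2)
qed

lemma sup_norm_restrict_fun_le:
  assumes "bdd_above (range (\<lambda>e. \<bar>f e\<bar>))"
  shows "sup_norm (restrict_fun \<E>' f) \<le> sup_norm f"
  unfolding sup_norm_def
proof (rule cSUP_mono)
  show "\<exists>e'\<in>UNIV. \<bar>restrict_fun \<E>' f e\<bar> \<le> \<bar>f e'\<bar>" for e
    by (rule bexI[of _ e]) (auto simp: restrict_fun_def)
qed (use assms in auto)

lemma sup_norm_nonneg:
  assumes "bdd_above (range (\<lambda>e. \<bar>f e\<bar>))"
  shows "0 \<le> sup_norm f"
  unfolding sup_norm_def using cSUP_upper2[OF assms, of undefined 0] by simp

lemma strictly_positive_stress_suminf:
  fixes \<E>' :: "nat \<Rightarrow> 'v edge set"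
  assumes compact: "compact_space (edge_topology p \<E>)"
    and sub: "\<And>n. \<E>' n \<subseteq> \<E>"
    and stress: "\<And>n. strictly_positive_stress p \<X> (\<E>' n) (\<mu> n)"
    and dense: "edge_topology p \<E> closure_of (\<Union>n. \<E>' n) = \<E>"
  shows "\<exists>\<nu>. strictly_positive_stress p \<X> \<E> \<nu>"
proof -
  note dual = stress[unfolded strictly_positive_stress_def stress_def dual_space_def]
  have \<mu>_add: "\<mu> n (\<lambda>e. f e + g e) = \<mu> n f + \<mu> n g"
    if "f \<in> cont_fun p (\<E>' n)" "g \<in> cont_fun p (\<E>' n)" for n f g
    using dual[of n] that by simp
  have \<mu>_scale: "\<mu> n (\<lambda>e. c * f e) = c * \<mu> n f" if "f \<in> cont_fun p (\<E>' n)" for n c f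
    using dual[of n] that by simp
  have \<mu>_pos: "0 < \<mu> n f"
    if "f \<in> cont_fun p (\<E>' n)" "\<forall>e\<in>\<E>' n. 0 \<le> f e" "f \<noteq> (\<lambda>e. 0)" for n f
    using dual[of n] that by simp
  have \<mu>_rigidity: "\<mu> n (rigidity p (\<E>' n) V) = 0" if "V \<in> \<X>" for n V
    using dual[of n] that by simp
  have "\<exists>K. \<forall>f\<in>cont_fun p (\<E>' n). \<bar>\<mu> n f\<bar> \<le> sup_norm f * K" for n
    using dual[of n] by simp
  then obtain K where K: "\<And>n f. f \<in> cont_fun p (\<E>' n) \<Longrightarrow> \<bar>\<mu> n f\<bar> \<le> sup_norm f * K n"
    by metis
  \<comment> \<open>Dividing by \<open>1 + \<bar>K n\<bar>\<close> cancels the norm bound of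
    \<open>\<mu> n\<close>, with 1 added to keep the denominator positive; the factor
    \<open>(1/2) ^ n\<close> then makes the norms summable.\<close>
  define w where "w n = (1/2) ^ n / (1 + \<bar>K n\<bar>)" for n
  define \<nu> where "\<nu> f = (\<Sum>n. w n * \<mu> n (restrict_fun (\<E>' n) f))" for f
  have w_pos: "0 < w n" for n by (simp add: w_def add_pos_nonneg)
  have w_K: "w n * \<bar>K n\<bar> \<le> (1/2) ^ n" for n
    by (simp add: w_def field_simps add_pos_nonneg)
  note R = restrict_fun_cont_fun[OF sub]

  have bound: "\<bar>w n * \<mu> n (restrict_fun (\<E>' n) f)\<bar> \<le> sup_norm f * (1/2) ^ n"
    if f: "f \<in> cont_fun p \<E>" for f n
  proof -
    let ?r = "restrict_fun (\<E>' n) f"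
    note bdd = cont_fun_bdd_above[OF compact f]
    \<comment> \<open>A bound for \<open>f\<close> also bounds its restriction, so the norm of the
      restriction is nonnegative. This is needed to replace \<open>K n\<close>, which may be
      negative, by its absolute value.\<close>
    obtain b where b: "\<And>e. \<bar>f e\<bar> \<le> b" using bdd by (auto simp: bdd_above_def)
    have "\<bar>?r e\<bar> \<le> b" for e using b[of e] by (auto simp: restrict_fun_def)
    then have "0 \<le> sup_norm ?r" by (intro sup_norm_nonneg bdd_aboveI2)
    have "\<bar>\<mu> n ?r\<bar> \<le> sup_norm ?r * K n" by (rule K[OF R[OF f]])
    also have "\<dots> \<le> sup_norm ?r * \<bar>K n\<bar>"
      using \<open>0 \<le> sup_norm ?r\<close> by (intro mult_left_mono) auto
    also have "\<dots> \<le> sup_norm f * \<bar>K n\<bar>"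
      by (intro mult_right_mono sup_norm_restrict_fun_le[OF bdd]) auto
    finally have "w n * \<bar>\<mu> n ?r\<bar> \<le> w n * (sup_norm f * \<bar>K n\<bar>)"
      using w_pos[of n] by (intro mult_left_mono) auto
    also have "\<dots> = sup_norm f * (w n * \<bar>K n\<bar>)" by simp
    also have "\<dots> \<le> sup_norm f * (1/2) ^ n"
      by (intro mult_left_mono w_K sup_norm_nonneg bdd)
    finally show ?thesis using w_pos[of n] by (simp add: abs_mult)
  qed
  have geometric: "(\<lambda>n. sup_norm f * (1/2) ^ n) sums (sup_norm f * 2)" for f :: "'v edge \<Rightarrow> real"
    using sums_mult[OF geometric_sums[of "1/2 :: real"], of "sup_norm f"] by simp
  have summable: "summable (\<lambda>n. w n * \<mu> n (restrict_fun (\<E>' n) f))"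
    if "f \<in> cont_fun p \<E>" for f
    by (rule summable_comparison_test'[OF sums_summable[OF geometric[of f]], of 0])
      (use bound[OF that] in \<open>simp only: real_norm_def\<close>)

  have "\<nu> (\<lambda>e. f e + g e) = \<nu> f + \<nu> g" if f: "f \<in> cont_fun p \<E>" and g: "g \<in> cont_fun p \<E>" for f g
  proof -
    have "\<mu> n (restrict_fun (\<E>' n) (\<lambda>e. f e + g e)) =
        \<mu> n (restrict_fun (\<E>' n) f) + \<mu> n (restrict_fun (\<E>' n) g)" for n
      unfolding restrict_fun_add by (rule \<mu>_add[OF R[OF f] R[OF g]])
    then show ?thesis
      unfolding \<nu>_def suminf_add[OF summable[OF f] summable[OF g]] by (simp add: distrib_left)
  qed
  moreover have "\<nu> (\<lambda>e. c * f e) = c * \<nu> f" if f: "f \<in> cont_fun p \<E>" for c f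
  proof -
    have "\<mu> n (restrict_fun (\<E>' n) (\<lambda>e. c * f e)) = c * \<mu> n (restrict_fun (\<E>' n) f)" for n
      unfolding restrict_fun_scale by (rule \<mu>_scale[OF R[OF f]])
    then show ?thesis
      unfolding \<nu>_def suminf_mult[OF summable[OF f], symmetric] by (simp add: mult.left_commute)
  qed
  \<comment> \<open>The sum 2 of the geometric series serves as \<open>L\<close> for all
    \<open>f\<close> at once.\<close>
  moreover have "\<exists>L. \<forall>f\<in>cont_fun p \<E>. \<bar>\<nu> f\<bar> \<le> sup_norm f * L"
  proof (intro exI ballI)
    fix f assume f: "f \<in> cont_fun p \<E>"
    have "norm (\<nu> f) \<le> (\<Sum>n. sup_norm f * (1/2) ^ n)"
      unfolding \<nu>_def
      by (rule norm_suminf_le[OF _ sums_summable[OF geometric]])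
        (use bound[OF f] in \<open>simp only: real_norm_def\<close>)
    then show "\<bar>\<nu> f\<bar> \<le> sup_norm f * 2" unfolding sums_unique[OF geometric, symmetric] by simp
  qed
  \<comment> \<open>The restriction of \<open>rigidity p \<E> V\<close> is the rigidity operator of
    the subtensegrity applied to \<open>V\<close>, so every term of the series vanishes.\<close>
  moreover have "\<nu> (rigidity p \<E> V) = 0" if "V \<in> \<X>" for V
  proof -
    have "\<mu> n (restrict_fun (\<E>' n) (rigidity p \<E> V)) = 0" for n
      unfolding restrict_fun_rigidity[OF sub] by (rule \<mu>_rigidity[OF that])
    then show ?thesis by (simp add: \<nu>_def)
  qed
  moreover have "0 < \<nu> f"
    if f: "f \<in> cont_fun p \<E>" and nonneg: "\<forall>e\<in>\<E>. 0 \<le> f e" and nonzero: "f \<noteq> (\<lambda>e. 0)" for f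
  proof -
    let ?U = "{e \<in> \<E>. 0 < f e}"
    have f_cont: "continuous_map (edge_topology p \<E>) euclideanreal f"
      and f_zero: "\<And>e. e \<notin> \<E> \<Longrightarrow> f e = 0"
      using f by (auto simp: cont_fun_def)
    from nonzero obtain e where "f e \<noteq> 0" by auto
    then have e: "e \<in> ?U" using f_zero nonneg by force
    have U: "openin (edge_topology p \<E>) ?U"
      using openin_continuous_map_preimage[OF f_cont, of "{0<..}"]
      by (simp add: topspace_edge_topology)
    have "e \<in> edge_topology p \<E> closure_of (\<Union>n. \<E>' n)"
      using dense e by simp
    then have "\<forall>T. e \<in> T \<and> openin (edge_topology p \<E>) T \<longrightarrow> (\<exists>d. d \<in> (\<Union>n. \<E>' n) \<and> d \<in> T)"
      unfolding in_closure_of by (rule conjunct2)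
    from this[rule_format, OF conjI[OF e U]]
    obtain n d where d: "d \<in> \<E>' n" "0 < f d" by auto
    \<comment> \<open>Strict positivity of \<open>\<mu> m\<close> says nothing about the zero
      function, and \<open>f\<close> may vanish on all of \<open>\<E>' m\<close>; that case follows
      from homogeneity with factor 0.\<close>
    have term_nonneg: "0 \<le> \<mu> m (restrict_fun (\<E>' m) f)" for m
    proof (cases "restrict_fun (\<E>' m) f = (\<lambda>e. 0)")
      case True
      have "\<mu> m (\<lambda>e. 0 * restrict_fun (\<E>' m) f e) = 0 * \<mu> m (restrict_fun (\<E>' m) f)"
        by (rule \<mu>_scale[OF R[OF f]])
      then show ?thesis using True by simp
    next
      case False
      moreover have "\<forall>e\<in>\<E>' m. 0 \<le> restrict_fun (\<E>' m) f e"
        using nonneg sub by (auto simp: restrict_fun_def)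
      ultimately have "0 < \<mu> m (restrict_fun (\<E>' m) f)"
        using \<mu>_pos[OF R[OF f]] by simp
      then show ?thesis by simp
    qed
    \<comment> \<open>Density gave a \<open>d\<close> in \<open>\<E>' n\<close> with
      \<open>f d\<close> positive, so the term with index \<open>n\<close> is strictly positive, and
      the other terms cannot cancel it.\<close>
    have "restrict_fun (\<E>' n) f d \<noteq> 0" using d by (simp add: restrict_fun_def)
    then have "restrict_fun (\<E>' n) f \<noteq> (\<lambda>e. 0)" by metis
    moreover have "\<forall>e\<in>\<E>' n. 0 \<le> restrict_fun (\<E>' n) f e"
      using nonneg sub by (auto simp: restrict_fun_def)
    ultimately have "0 < \<mu> n (restrict_fun (\<E>' n) f)"
      using \<mu>_pos[OF R[OF f]] by simp
    then show ?thesis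
      unfolding \<nu>_def using w_pos term_nonneg
      by (intro suminf_pos2[OF summable[OF f], of n]) (auto simp: less_imp_le)
  qed
  ultimately have "strictly_positive_stress p \<X> \<E> \<nu>"
    unfolding strictly_positive_stress_def stress_def dual_space_def by simp
  then show ?thesis by (rule exI[where x = \<nu>])
qed

theorem theorem3p9p2:
  fixes \<V> :: "'v set" and p :: "'v \<Rightarrow> real^'n" and S C B :: "'v set set"
    and \<X> :: "('v \<Rightarrow> real^'n) set"
  assumes "tensegrity \<V> p S C B \<X>"
    and "countably_covered p (edgeset S C B)
           (\<lambda>\<E>'. \<exists>\<mu>. strictly_positive_stress p \<X> \<E>' \<mu>)"
  shows "\<exists>\<mu>. strictly_positive_stress p \<X> (edgeset S C B) \<mu>"
proof -
  let ?E = "edgeset S C B"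
  have compact: "compact_space (edge_topology p ?E)"
    using assms(1) by (simp add: tensegrity_def)
  obtain D where D: "countable D" "D \<subseteq> ?E" "edge_topology p ?E closure_of D = ?E"
    and "\<forall>e\<in>D. \<exists>\<E>'. compactin (edge_topology p ?E) \<E>' \<and>
      (\<exists>\<mu>. strictly_positive_stress p \<X> \<E>' \<mu>) \<and> e \<in> \<E>'"
    using assms(2) unfolding countably_covered_def by blast
  then obtain F \<mu> where F: "\<And>e. e \<in> D \<Longrightarrow> compactin (edge_topology p ?E) (F e)"
    "\<And>e. e \<in> D \<Longrightarrow> strictly_positive_stress p \<X> (F e) (\<mu> e)" "\<And>e. e \<in> D \<Longrightarrow> e \<in> F e"
    by metis
  have F_sub: "F e \<subseteq> ?E" if "e \<in> D" for e
    using compactin_subset_topspace[OF F(1)[OF that]] by (simp add: topspace_edge_topology)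
  show ?thesis
  proof (cases "D = {}")
    \<comment> \<open>An empty dense set forces an empty edgeset. The only continuous function is
      then zero, so the zero functional is strictly positive vacuously.\<close>
    case True
    then have "?E = {}" using D(3) by simp
    then have "strictly_positive_stress p \<X> ?E (\<lambda>f. 0)"
      by (auto simp: strictly_positive_stress_def stress_def dual_space_def cont_fun_def
          intro: exI[of _ 0])
    then show ?thesis by (rule exI[where x = "\<lambda>f. 0"])
  next
    case False
    \<comment> \<open>This enumeration repeats elements if \<open>D\<close> is finite, so finite and
      infinite \<open>D\<close> both yield a sequence of subtensegrities; a repeated stress merely
      contributes several terms.\<close>
    let ?d = "from_nat_into D"
    have d: "?d n \<in> D" for n using False by (rule from_nat_into)
    \<comment> \<open>Each \<open>e\<close> in \<open>D\<close> lies in its own \<open>F e\<close>,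
      so the union of these edgesets inherits density from \<open>D\<close>.\<close>
    have "D \<subseteq> (\<Union>n. F (?d n))"
      using F(3) from_nat_into_surj[OF D(1)] by fastforce
    then have "?E \<subseteq> edge_topology p ?E closure_of (\<Union>n. F (?d n))"
      using closure_of_mono D(3) by metis
    then have "edge_topology p ?E closure_of (\<Union>n. F (?d n)) = ?E"
      using closure_of_subset_topspace[of "edge_topology p ?E"]
      by (fastforce simp: topspace_edge_topology)
    then show ?thesis
      by (rule strictly_positive_stress_suminf[OF compact F_sub[OF d] F(2)[OF d]])
  qed
qed

end
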